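(* If $G$ is a connected graph of order $n\geq 3$ such that $\Gamma_t(G)<n-1$, then $d_0(G)\leq \min\{n-1,\ \Gamma_t(G)+\gamma_t(G)\}$.
   Context: A total dominating set (TDS) of a graph $G$ without isolated vertices is a set $S\subseteq V(G)$ such that every vertex of $G$ is adjacent to a vertex of $S$. A minimal TDS (MTDS) is a TDS no proper subset of which is a TDS. $\gamma_t(G)$ is the minimum cardinality of a TDS and $\Gamma_t(G)$ the maximum cardinality of an MTDS. For a positive integer $k$, $D_k^t(G)$ is the graph whose vertices are the TDSs of $G$ of cardinality at most $k$, two being adjacent if and only if one is obtained from the other by adding or deleting a single vertex. $d_0(G)$ is the smallest integer $\ell$ such that $D_k^t(G)$ is connected for all $k\geq \ell$. *)

theory Defs
  imports "Graph_Theory.Graph_Theory"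
begin

text \<open>
  A finite simple graph is a \<open>pair_graph\<close>: a finite vertex set with a symmetric irreflexive
  arc relation.  \<open>connected\<close> (from \<open>Graph_Theory.Digraph_Component\<close>) requires a
  nonempty vertex set.
\<close>

definition total_dominating_set :: "'a pair_pre_digraph \<Rightarrow> 'a set \<Rightarrow> bool" where
  "total_dominating_set G S \<longleftrightarrow>
     S \<subseteq> pverts G \<and> (\<forall>v \<in> pverts G. \<exists>u \<in> S. v \<rightarrow>\<^bsub>with_proj G\<^esub> u)"

definition minimal_total_dominating_set :: "'a pair_pre_digraph \<Rightarrow> 'a set \<Rightarrow> bool" where
  "minimal_total_dominating_set G S \<longleftrightarrow>
     total_dominating_set G S \<and> (\<forall>T. T \<subset> S \<longrightarrow> \<not> total_dominating_set G T)"

definition total_domination_number :: "'a pair_pre_digraph \<Rightarrow> nat" where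
  "total_domination_number G = Min (card ` {S. total_dominating_set G S})"

definition upper_total_domination_number :: "'a pair_pre_digraph \<Rightarrow> nat" where
  "upper_total_domination_number G = Max (card ` {S. minimal_total_dominating_set G S})"

definition total_dominating_graph :: "nat \<Rightarrow> 'a pair_pre_digraph \<Rightarrow> 'a set pair_pre_digraph" where
  "total_dominating_graph k G =
     (let V = {S. total_dominating_set G S \<and> card S \<le> k} in
      \<lparr> pverts = V,
        parcs = {(S, T). S \<in> V \<and> T \<in> V \<and>
                   ((\<exists>v. v \<notin> S \<and> T = insert v S) \<or> (\<exists>v. v \<in> S \<and> T = S - {v}))} \<rparr>)"

text \<open>
  For \<open>k\<close> below the total domination number, in particular for \<open>k = 0\<close> when \<open>G\<close> is nonempty,
  \<open>total_dominating_graph k G\<close> has no vertices and hence is not \<open>connected\<close>.  It is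
  therefore immaterial that \<open>k\<close> ranges over all naturals rather than the positive ones.
\<close>

definition total_d0 :: "'a pair_pre_digraph \<Rightarrow> nat" where
  "total_d0 G = (LEAST l. \<forall>k \<ge> l. Digraph_Component.connected (with_proj (total_dominating_graph k G)))"

lemma total_dominating_graph_pair_graph:
  assumes "pair_graph G"
  shows "pair_graph (total_dominating_graph k G)"
proof -
  interpret pair_graph G by fact
  have "pverts (total_dominating_graph k G) \<subseteq> Pow (pverts G)"
    by (auto simp: total_dominating_graph_def total_dominating_set_def Let_def)
  then have f: "finite (pverts (total_dominating_graph k G))"
    by (rule finite_subset) (simp add: pair_finite_verts)
  have "parcs (total_dominating_graph k G) \<subseteq>
      pverts (total_dominating_graph k G) \<times> pverts (total_dominating_graph k G)"
    by (auto simp: total_dominating_graph_def Let_def)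
  then have g: "finite (parcs (total_dominating_graph k G))"
    by (rule finite_subset) (simp add: f)
  show ?thesis
  proof
    show "symmetric (with_proj (total_dominating_graph k G))"
      unfolding symmetric_def with_proj_simps
      by (rule symI) (auto simp: total_dominating_graph_def Let_def insert_absorb)
  qed (use f g in \<open>auto simp: total_dominating_graph_def Let_def\<close>)
qed

text \<open>Without isolated vertices the minimum defining \<open>total_d0\<close> exists.\<close>

lemma total_d0_exists:
  assumes "pair_graph G" and iso: "\<And>v. v \<in> pverts G \<Longrightarrow> \<exists>u. v \<rightarrow>\<^bsub>with_proj G\<^esub> u"
  shows "\<exists>l. \<forall>k \<ge> l. Digraph_Component.connected (with_proj (total_dominating_graph k G))"
proof (intro exI allI impI)
  fix k assume k: "card (pverts G) \<le> k"
  interpret pair_graph G by fact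
  let ?D = "total_dominating_graph k G"
  interpret D: pair_graph ?D by (rule total_dominating_graph_pair_graph) fact
  have fin: "finite (pverts G)" by (rule pair_finite_verts)
  have V: "pverts ?D = {S. total_dominating_set G S}"
  proof -
    have "card S \<le> k" if "total_dominating_set G S" for S
      using that k card_mono[OF fin, of S] by (simp add: total_dominating_set_def)
    then show ?thesis by (auto simp: total_dominating_graph_def Let_def)
  qed
  have top: "pverts G \<in> pverts ?D"
    using iso in_arcsD2 unfolding V total_dominating_set_def with_proj_simps by blast
  have up: "S \<rightarrow>\<^sup>*\<^bsub>with_proj ?D\<^esub> pverts G" if "S \<in> pverts ?D" for S
    using that
  proof (induction "card (pverts G - S)" arbitrary: S rule: less_induct)
    case less
    then have sub: "S \<subseteq> pverts G" by (simp add: V total_dominating_set_def)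
    show ?case
    proof (cases "S = pverts G")
      case True then show ?thesis using top by simp
    next
      case False
      then obtain v where v: "v \<in> pverts G" "v \<notin> S" using sub by blast
      let ?T = "insert v S"
      have T: "?T \<in> pverts ?D"
        using less.prems v by (auto simp: V total_dominating_set_def)
      have "card (pverts G - ?T) < card (pverts G - S)"
        using v fin by (intro psubset_card_mono) auto
      then have r: "?T \<rightarrow>\<^sup>*\<^bsub>with_proj ?D\<^esub> pverts G" using less.hyps T by blast
      have "(S, ?T) \<in> parcs ?D"
        using T less.prems v unfolding total_dominating_graph_def Let_def by auto
      then have "S \<rightarrow>\<^bsub>with_proj ?D\<^esub> ?T" by simp
      then show ?thesis using r by (rule wf_digraph.adj_reachable_trans[OF D.wf_digraph])
    qed
  qed
  have "strongly_connected (with_proj ?D)"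
  proof (rule strongly_connectedI)
    show "verts (with_proj ?D) \<noteq> {}" using top by auto
    fix S T assume "S \<in> verts (with_proj ?D)" "T \<in> verts (with_proj ?D)"
    then have "S \<rightarrow>\<^sup>*\<^bsub>with_proj ?D\<^esub> pverts G" "pverts G \<rightarrow>\<^sup>*\<^bsub>with_proj ?D\<^esub> T"
      using up symmetric_reachable[OF D.pair_sym_arcs] by auto
    then show "S \<rightarrow>\<^sup>*\<^bsub>with_proj ?D\<^esub> T" by (rule D.reachable_trans)
  qed
  moreover have sym: "arcs_ends (with_proj ?D) \<subseteq> (arcs_ends (with_proj ?D))\<^sup>s"
    by (auto simp: symcl_def)
  ultimately show "Digraph_Component.connected (with_proj ?D)"
    unfolding Digraph_Component.connected_conv strongly_connected_def reachable_def
    by (meson rtrancl_on_mono[OF sym subset_refl])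
qed

end

theory Submission
  imports Defs
begin

text \<open>
  Every total dominating set shrinks to a minimal one, and two nested total dominating sets are
  joined by adding vertices one by one.  For \<open>k \<ge> \<Gamma>\<^sub>t + \<gamma>\<^sub>t\<close> a minimal set is therefore joined to a fixed minimum
  one through their union.  For \<open>k = n - 1\<close> it suffices to join the sets \<open>V - {x}\<close>.  If
  \<open>V - {x}\<close> and \<open>V - {y}\<close> are not joined, then \<open>{x, y}\<close> is the neighbourhood of some vertex, as
  otherwise \<open>V - {x, y}\<close> would join them.  As \<open>\<Gamma>\<^sub>t < n - 1\<close>, every such \<open>V - {x}\<close> is joined to
  another \<open>V - {x'}\<close>, so two components would contain two such vertices each, and all four cross
  pairs would be neighbourhoods; this is impossible.
\<close>

context pair_graph
begin

section \<open>Paths between total dominating sets\<close>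

abbreviation tds_joined :: "nat \<Rightarrow> 'a set \<Rightarrow> 'a set \<Rightarrow> bool" where
  "tds_joined k S T \<equiv> S \<rightarrow>\<^sup>*\<^bsub>with_proj (total_dominating_graph k G)\<^esub> T"

lemma in_total_dominating_graph_iff:
  "S \<in> pverts (total_dominating_graph k G) \<longleftrightarrow> total_dominating_set G S \<and> card S \<le> k"
  by (simp add: total_dominating_graph_def Let_def)

lemma total_dominating_set_subset: "total_dominating_set G S \<Longrightarrow> S \<subseteq> pverts G"
  by (simp add: total_dominating_set_def)

lemma total_dominating_set_mono:
  "total_dominating_set G S \<Longrightarrow> S \<subseteq> T \<Longrightarrow> T \<subseteq> pverts G \<Longrightarrow> total_dominating_set G T"
  unfolding total_dominating_set_def by blast

lemma finite_total_dominating_sets: "finite {S. total_dominating_set G S}"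
  by (rule finite_subset[of _ "Pow (pverts G)"]) (auto simp: total_dominating_set_def pair_finite_verts)

lemma tds_joined_sym: "tds_joined k S T \<Longrightarrow> tds_joined k T S"
proof -
  interpret D: pair_graph "total_dominating_graph k G"
    by (rule total_dominating_graph_pair_graph) unfold_locales
  show "tds_joined k S T \<Longrightarrow> tds_joined k T S"
    by (rule symmetric_reachable[OF D.pair_sym_arcs])
qed

lemma tds_joined_trans: "tds_joined k S T \<Longrightarrow> tds_joined k T U \<Longrightarrow> tds_joined k S U"
proof -
  interpret D: pair_graph "total_dominating_graph k G"
    by (rule total_dominating_graph_pair_graph) unfold_locales
  show "tds_joined k S T \<Longrightarrow> tds_joined k T U \<Longrightarrow> tds_joined k S U"
    by (rule D.reachable_trans)
qed

text \<open>Every set on the way from \<open>S\<close> to \<open>T\<close> contains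
  \<open>S\<close>, so it is total dominating, and lies in \<open>T\<close>, so the bound on
  \<open>card T\<close> covers the whole path.\<close>

lemma tds_joined_subset:
  assumes "total_dominating_set G S" "S \<subseteq> T" "T \<subseteq> pverts G" "card T \<le> k"
  shows "tds_joined k S T"
  using assms
proof (induction "card (T - S)" arbitrary: S rule: less_induct)
  case less
  let ?D = "total_dominating_graph k G"
  interpret D: pair_graph ?D by (rule total_dominating_graph_pair_graph) unfold_locales
  have finT: "finite T" using less.prems(3) pair_finite_verts finite_subset by blast
  have vert: "U \<in> pverts ?D" if "S \<subseteq> U" "U \<subseteq> T" for U
    using that less.prems total_dominating_set_mono[of S U] card_mono[OF finT, of U]
    by (auto simp: in_total_dominating_graph_iff)
  show ?case
  proof (cases "S = T")
    case True
    then show ?thesis using vert[of S] by simp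
  next
    case False
    then obtain v where v: "v \<in> T" "v \<notin> S" using less.prems by blast
    let ?U = "insert v S"
    have "card (T - ?U) < card (T - S)"
      using v finT by (intro psubset_card_mono) auto
    moreover have "total_dominating_set G ?U"
      using vert[of ?U] v less.prems by (auto simp: in_total_dominating_graph_iff)
    ultimately have "tds_joined k ?U T"
      using less v by blast
    moreover have "(S, ?U) \<in> parcs ?D"
      using vert[of S] vert[of ?U] v less.prems unfolding total_dominating_graph_def Let_def by auto
    then have "S \<rightarrow>\<^bsub>with_proj ?D\<^esub> ?U" by simp
    ultimately show ?thesis
      by (rule wf_digraph.adj_reachable_trans[OF D.wf_digraph, rotated])
  qed
qed

text \<open>The path climbs from \<open>S\<close> to the union and then descends to
  \<open>T\<close>.\<close>

lemma tds_joined_union: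
  assumes "total_dominating_set G S" "total_dominating_set G T" "card (S \<union> T) \<le> k"
  shows "tds_joined k S T"
  using assms tds_joined_subset[of S "S \<union> T" k] tds_joined_subset[of T "S \<union> T" k]
    tds_joined_sym tds_joined_trans total_dominating_set_subset
  by (metis Un_least Un_upper1 Un_upper2)

text \<open>\<open>R\<close> supplies the nonempty vertex set that connectedness demands.\<close>

lemma total_dominating_graph_connectedI:
  assumes "total_dominating_set G R" "card R \<le> k"
    and "\<And>S T. total_dominating_set G S \<Longrightarrow> card S \<le> k \<Longrightarrow>
           total_dominating_set G T \<Longrightarrow> card T \<le> k \<Longrightarrow> tds_joined k S T"
  shows "Digraph_Component.connected (with_proj (total_dominating_graph k G))"
proof -
  let ?D = "total_dominating_graph k G"
  have "strongly_connected (with_proj ?D)"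
    using assms by (intro strongly_connectedI) (auto simp: in_total_dominating_graph_iff)
  \<comment> \<open>\<open>connected\<close> is strong connectedness of the symmetric closure, which
    keeps all arcs and hence all paths.\<close>
  moreover have sym: "arcs_ends (with_proj ?D) \<subseteq> (arcs_ends (with_proj ?D))\<^sup>s"
    by (auto simp: symcl_def)
  ultimately show ?thesis
    unfolding Digraph_Component.connected_conv strongly_connected_def reachable_def
    by (meson rtrancl_on_mono[OF sym subset_refl])
qed

section \<open>Minimal sets and the sum bound\<close>

lemma minimal_total_dominating_subset:
  assumes "total_dominating_set G S"
  obtains M where "M \<subseteq> S" "total_dominating_set G M"
    "card M \<le> upper_total_domination_number G"
proof -
  obtain M where M: "M \<subseteq> S" "total_dominating_set G M"
    and min: "\<forall>T\<in>{T. total_dominating_set G T}. T \<subseteq> M \<longrightarrow> M = T"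
    using finite_has_minimal2[OF finite_total_dominating_sets, of S] assms by auto
  have "minimal_total_dominating_set G M"
    unfolding minimal_total_dominating_set_def using M min by auto
  moreover have "finite {S. minimal_total_dominating_set G S}"
    using finite_total_dominating_sets by (rule rev_finite_subset)
      (auto simp: minimal_total_dominating_set_def)
  ultimately have "card M \<le> upper_total_domination_number G"
    unfolding upper_total_domination_number_def by (intro Max_ge) auto
  then show thesis using M that by blast
qed

lemma connected_above_sum:
  assumes "total_dominating_set G R"
    and k: "upper_total_domination_number G + total_domination_number G \<le> k"
  shows "Digraph_Component.connected (with_proj (total_dominating_graph k G))"
proof -
  \<comment> \<open>\<open>R\<close> makes the family nonempty, so the minimum is attained.\<close>
  have "total_domination_number G \<in> card ` {S. total_dominating_set G S}"
    unfolding total_domination_number_def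
    using assms(1) finite_total_dominating_sets by (intro Min_in) auto
  then obtain T where T: "total_dominating_set G T" "card T = total_domination_number G" by auto
  have joined: "tds_joined k S T" if S: "total_dominating_set G S" "card S \<le> k" for S
  proof -
    obtain M where M: "M \<subseteq> S" "total_dominating_set G M"
      "card M \<le> upper_total_domination_number G"
      using minimal_total_dominating_subset[OF S(1)] .
    have "card (M \<union> T) \<le> k" using card_Un_le[of M T] M(3) T(2) k by linarith
    then have "tds_joined k M T" by (rule tds_joined_union[OF M(2) T(1)])
    moreover have "tds_joined k S M"
      by (rule tds_joined_sym[OF tds_joined_subset[OF M(2,1) total_dominating_set_subset[OF S(1)] S(2)]])
    ultimately show ?thesis using tds_joined_trans by blast
  qed
  show ?thesis
    using T k joined by (intro total_dominating_graph_connectedI[of T])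
      (auto intro: tds_joined_trans tds_joined_sym)
qed

section \<open>Vertices with two prescribed neighbours\<close>

lemma co_pair_neighbourhood:
  assumes "total_dominating_set G (pverts G - {x})" "total_dominating_set G (pverts G - {y})"
    and "\<not> total_dominating_set G (pverts G - {x, y})"
  obtains z where "z \<in> pverts G" "\<And>u. z \<rightarrow>\<^bsub>with_proj G\<^esub> u \<longleftrightarrow> u = x \<or> u = y"
proof -
  obtain z where z: "z \<in> pverts G" "\<And>u. u \<in> pverts G - {x, y} \<Longrightarrow> \<not> z \<rightarrow>\<^bsub>with_proj G\<^esub> u"
    using assms(3) unfolding total_dominating_set_def by blast
  \<comment> \<open>\<open>z\<close> has a neighbour other than \<open>x\<close> and one other than
    \<open>y\<close>; since nothing else is available, these are \<open>y\<close> and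
    \<open>x\<close>.\<close>
  then show thesis
    using that[of z] assms(1,2) in_arcsD2 unfolding total_dominating_set_def
    by (smt (verit) Diff_iff insert_iff empty_iff with_proj_simps(3))
qed

text \<open>
  Deleting the vertex \<open>z\<close> with neighbourhood \<open>{a, b}\<close> leaves a total dominating set, so \<open>z\<close> lies
  in \<open>A\<close> or \<open>B\<close>.  If \<open>z \<in> A\<close>, the vertex with neighbourhood \<open>{z, b}\<close> is adjacent to \<open>z\<close> and \<open>b\<close>,
  so it is \<open>a\<close>.  The vertex with neighbourhood \<open>{a, b'}\<close> is then \<open>b\<close>, hence \<open>z = b'\<close>, which lies in \<open>B\<close>.
\<close>

lemma no_complete_bipartite_neighbourhoods:
  assumes N: "\<And>a b. a \<in> A \<Longrightarrow> b \<in> B \<Longrightarrow>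
        \<exists>z\<in>pverts G. \<forall>u. z \<rightarrow>\<^bsub>with_proj G\<^esub> u \<longleftrightarrow> u = a \<or> u = b"
    and AB: "A \<inter> B = {}"
    and cover: "\<And>x. x \<in> pverts G \<Longrightarrow> total_dominating_set G (pverts G - {x}) \<Longrightarrow> x \<in> A \<union> B"
    and el: "a \<in> A" "a' \<in> A" "a \<noteq> a'" "b \<in> B" "b' \<in> B" "b \<noteq> b'"
    and iso: "\<And>v. v \<in> pverts G \<Longrightarrow> \<exists>u. v \<rightarrow>\<^bsub>with_proj G\<^esub> u"
  shows False
proof -
  have sym: "u \<rightarrow>\<^bsub>with_proj G\<^esub> v \<longleftrightarrow> v \<rightarrow>\<^bsub>with_proj G\<^esub> u" for u v
    using pair_sym_arcs by (metis symmetric_def symE with_proj_simps(3))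
  have irr: "\<not> u \<rightarrow>\<^bsub>with_proj G\<^esub> u" for u
    using pair_no_loops by fastforce
  \<comment> \<open>The case \<open>z \<in> A\<close>, stated for arbitrary sides so that exchanging
    \<open>A\<close> and \<open>B\<close> settles \<open>z \<in> B\<close>.\<close>
  have *: False
    if N: "\<And>a b. a \<in> A \<Longrightarrow> b \<in> B \<Longrightarrow>
        \<exists>z\<in>pverts G. \<forall>u. z \<rightarrow>\<^bsub>with_proj G\<^esub> u \<longleftrightarrow> u = a \<or> u = b"
      and AB: "A \<inter> B = {}" and el: "a \<in> A" "b \<in> B" "b' \<in> B" "b \<noteq> b'"
      and z: "\<forall>u. z \<rightarrow>\<^bsub>with_proj G\<^esub> u \<longleftrightarrow> u = a \<or> u = b" "z \<in> A"
    for A B a b b' z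
  proof -
    obtain w where w: "\<forall>u. w \<rightarrow>\<^bsub>with_proj G\<^esub> u \<longleftrightarrow> u = z \<or> u = b" using N z el by blast
    obtain z' where z': "\<forall>u. z' \<rightarrow>\<^bsub>with_proj G\<^esub> u \<longleftrightarrow> u = a \<or> u = b'" using N el by blast
    have "w = a \<or> w = b" using w z sym by blast
    then have wa: "w = a" using w irr by blast
    \<comment> \<open>\<open>z'\<close> is adjacent to \<open>a\<close>, which is \<open>w\<close>,
      so it is one of the two neighbours of \<open>w\<close>.\<close>
    then have "z' = z \<or> z' = b" using w z' sym by blast
    moreover have "z \<rightarrow>\<^bsub>with_proj G\<^esub> b" using z by blast
    moreover have "b \<noteq> a" using el AB by blast
    then have "\<not> z' \<rightarrow>\<^bsub>with_proj G\<^esub> b" using z' el(4) by simp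
    ultimately have "z' = b" by metis
    then have "z = a \<or> z = b'" using z z' sym by blast
    then show False using z irr AB el by blast
  qed
  obtain z where z: "z \<in> pverts G" "\<forall>u. z \<rightarrow>\<^bsub>with_proj G\<^esub> u \<longleftrightarrow> u = a \<or> u = b" using N el by blast
  obtain z' where z': "\<forall>u. z' \<rightarrow>\<^bsub>with_proj G\<^esub> u \<longleftrightarrow> u = a \<or> u = b'" using N el by blast
  obtain z'' where z'': "\<forall>u. z'' \<rightarrow>\<^bsub>with_proj G\<^esub> u \<longleftrightarrow> u = a' \<or> u = b" using N el by blast
  have neq: "a \<noteq> b" "a \<noteq> b'" "a' \<noteq> b" using AB el by blast+
  have "total_dominating_set G (pverts G - {z})"
    unfolding total_dominating_set_def
  proof (intro conjI ballI)
    fix v assume v: "v \<in> pverts G"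
    \<comment> \<open>A vertex with \<open>z\<close> as its only neighbour would be \<open>a\<close>
      or \<open>b\<close>. The second elements \<open>b'\<close> and \<open>a'\<close> exclude this:
      \<open>a\<close> is also adjacent to \<open>z'\<close> and \<open>b\<close> to
      \<open>z''\<close>, and both differ from \<open>z\<close> because their neighbourhoods
      do.\<close>
    have "\<exists>u. v \<rightarrow>\<^bsub>with_proj G\<^esub> u \<and> u \<noteq> z"
    proof (rule ccontr)
      assume H: "\<not> ?thesis"
      then have "v \<rightarrow>\<^bsub>with_proj G\<^esub> z" using iso[OF v] by blast
      then have "v = a \<or> v = b" using z sym by blast
      moreover have "a \<rightarrow>\<^bsub>with_proj G\<^esub> z'" "b \<rightarrow>\<^bsub>with_proj G\<^esub> z''"
        using z' z'' sym by metis+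
      moreover have "z' \<noteq> z" "z'' \<noteq> z"
        using neq z z' z'' el(3,6) by metis+
      ultimately show False using H by metis
    qed
    then show "\<exists>u\<in>pverts G - {z}. v \<rightarrow>\<^bsub>with_proj G\<^esub> u"
      using in_arcsD2 by fastforce
  qed auto
  then have "z \<in> A \<union> B" using cover z by blast
  moreover have False if "z \<in> A"
    by (rule *[of A B a b b' z]) (use N AB el z that in auto)
  moreover have False if "z \<in> B"
  proof (rule *[of B A b a a' z])
    fix c d assume "c \<in> B" "d \<in> A"
    then show "\<exists>z\<in>pverts G. \<forall>u. z \<rightarrow>\<^bsub>with_proj G\<^esub> u \<longleftrightarrow> u = c \<or> u = d"
      using N[of d c] by (simp only: disj_commute)
  qed (use AB el z that in auto)
  ultimately show False by blast
qed

section \<open>The bound n - 1\<close>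

lemma connected_card_minus_one:
  assumes iso: "\<And>v. v \<in> pverts G \<Longrightarrow> \<exists>u. v \<rightarrow>\<^bsub>with_proj G\<^esub> u"
    and R: "total_dominating_set G R"
    and upper: "upper_total_domination_number G < card (pverts G) - 1"
    and k: "k = card (pverts G) - 1"
  shows "Digraph_Component.connected (with_proj (total_dominating_graph k G))"
proof -
  define V where "V = pverts G"
  define P where "P = {x \<in> V. total_dominating_set G (V - {x})}"
  have fin: "finite V" by (simp add: V_def pair_finite_verts)
  have card_V: "card (V - {x}) = k" if "x \<in> V" for x
    using that fin by (simp add: k V_def)
  have co_pair: "tds_joined k (V - {x}) (V - {y})"
    if "x \<in> V" "y \<in> V" "total_dominating_set G (V - {x, y})" for x y
  proof -
    have *: "tds_joined k (V - {x, y}) (V - {u})" if "u = x \<or> u = y" for u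
      using that \<open>x \<in> V\<close> \<open>y \<in> V\<close> card_V \<open>total_dominating_set G (V - {x, y})\<close>
      by (intro tds_joined_subset) (auto simp: V_def)
    show ?thesis by (rule tds_joined_trans[OF tds_joined_sym[OF *] *]) auto
  qed
  have partner: "\<exists>x'\<in>P. x' \<noteq> x \<and> tds_joined k (V - {x}) (V - {x'})" if "x \<in> P" for x
  proof -
    have x: "x \<in> V" "total_dominating_set G (V - {x})" using that by (auto simp: P_def)
    obtain M where M: "M \<subseteq> V - {x}" "total_dominating_set G M"
      "card M \<le> upper_total_domination_number G"
      using minimal_total_dominating_subset[OF x(2)] .
    \<comment> \<open>The strict bound on \<Gamma>_t leaves room for a second vertex
      \<open>x'\<close> outside \<open>M\<close>; removing both \<open>x\<close> and
      \<open>x'\<close> still leaves a superset of \<open>M\<close>.\<close>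
    have "card M < card (V - {x})" using M(3) upper card_V[OF x(1)] k by simp
    then obtain x' where x': "x' \<in> V - {x}" "x' \<notin> M"
      using M(1) by (metis less_irrefl subsetI subset_antisym)
    then have "total_dominating_set G (V - {x, x'})"
      using M by (intro total_dominating_set_mono[OF M(2)]) (auto simp: V_def)
    moreover from this have "total_dominating_set G (V - {x'})"
      by (rule total_dominating_set_mono) (auto simp: V_def)
    ultimately show ?thesis using co_pair x x' by (auto simp: P_def)
  qed
  have co_joined: "tds_joined k (V - {x}) (V - {y})" if xy: "x \<in> P" "y \<in> P" for x y
  proof (rule ccontr)
    assume nj: "\<not> ?thesis"
    \<comment> \<open>\<open>A\<close> collects the vertices of \<open>P\<close> whose complements
      lie in the component of \<open>V - {x}\<close>; no complement from \<open>P - A\<close> is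
      joined to one from \<open>A\<close>.\<close>
    define A where "A = {u \<in> P. tds_joined k (V - {x}) (V - {u})}"
    \<comment> \<open>Going to the partner and back puts \<open>x\<close> itself into
      \<open>A\<close>.\<close>
    have xx: "tds_joined k (V - {x}) (V - {x})"
      using partner[OF xy(1)] tds_joined_sym tds_joined_trans by blast
    obtain x' where x': "x' \<in> A" "x' \<noteq> x" using partner[OF xy(1)] by (auto simp: A_def)
    obtain y' where y': "y' \<in> P" "y' \<noteq> y" "tds_joined k (V - {y}) (V - {y'})"
      using partner[OF xy(2)] by blast
    \<comment> \<open>If \<open>y'\<close> were in \<open>A\<close>, then \<open>V - {x}\<close>
      would be joined to \<open>V - {y}\<close> through \<open>V - {y'}\<close>.\<close>
    have y'A: "y' \<in> P - A" using y' nj tds_joined_sym tds_joined_trans unfolding A_def by blast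
    show False
    proof (rule no_complete_bipartite_neighbourhoods[of A "P - A" x x' y y'])
      fix a b assume ab: "a \<in> A" "b \<in> P - A"
      then have "\<not> tds_joined k (V - {a}) (V - {b})"
        unfolding A_def using tds_joined_trans by blast
      then have "\<not> total_dominating_set G (V - {a, b})"
        using co_pair[of a b] ab by (auto simp: A_def P_def)
      then show "\<exists>z\<in>pverts G. \<forall>u. z \<rightarrow>\<^bsub>with_proj G\<^esub> u \<longleftrightarrow> u = a \<or> u = b"
        using co_pair_neighbourhood[of a b] ab unfolding A_def P_def V_def by blast
    qed (use xy x' y' y'A nj xx iso in \<open>auto simp: A_def P_def V_def\<close>)
  qed
  have to_co: "\<exists>x\<in>P. tds_joined k S (V - {x})" if S: "total_dominating_set G S" "card S \<le> k" for S
  proof -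
    have SV: "S \<subseteq> V" using S total_dominating_set_subset by (simp add: V_def)
    \<comment> \<open>\<open>upper\<close> forces n - 1 to be positive, so the truncated subtraction
      is exact and \<open>S\<close> misses a vertex.\<close>
    have "card S < card V" using S(2) k upper by (simp add: V_def)
    then obtain x where x: "x \<in> V" "x \<notin> S"
      using SV by (metis less_irrefl subsetI subset_antisym)
    then have "total_dominating_set G (V - {x})"
      using SV by (intro total_dominating_set_mono[OF S(1)]) (auto simp: V_def)
    moreover have "tds_joined k S (V - {x})"
      using SV x card_V by (intro tds_joined_subset[OF S(1)]) (auto simp: V_def)
    ultimately show ?thesis using x by (auto simp: P_def)
  qed
  obtain M where M: "total_dominating_set G M" "card M \<le> upper_total_domination_number G"
    using minimal_total_dominating_subset[OF R] .
  show ?thesis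
  proof (rule total_dominating_graph_connectedI[OF M(1)])
    show "card M \<le> k" using M upper k by simp
    fix S T assume "total_dominating_set G S" "card S \<le> k" "total_dominating_set G T" "card T \<le> k"
    then show "tds_joined k S T"
      using to_co co_joined tds_joined_sym tds_joined_trans by meson
  qed
qed

section \<open>Larger k, isolated vertices and the conclusion\<close>

lemma connected_at_order:
  assumes "total_dominating_set G R" "card (pverts G) \<le> k"
  shows "Digraph_Component.connected (with_proj (total_dominating_graph k G))"
proof (rule total_dominating_graph_connectedI[OF assms(1)])
  \<comment> \<open>From n on the size bound excludes nothing, so any union is admissible.\<close>
  have le: "card U \<le> k" if "U \<subseteq> pverts G" for U
    using that assms(2) card_mono[OF pair_finite_verts] by (meson le_trans)
  then show "card R \<le> k" using assms(1) total_dominating_set_subset by blast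
  fix S T assume "total_dominating_set G S" "total_dominating_set G T"
  then show "tds_joined k S T"
    using le total_dominating_set_subset by (intro tds_joined_union) auto
qed

text \<open>A path from \<open>v\<close> to a second vertex starts with an arc at
  \<open>v\<close>.\<close>

lemma connected_no_isolated:
  assumes "Digraph_Component.connected (with_proj G)" "card (pverts G) \<ge> 2" "v \<in> pverts G"
  shows "\<exists>u. v \<rightarrow>\<^bsub>with_proj G\<^esub> u"
proof -
  have "\<not> pverts G \<subseteq> {v}" using assms(2) card_mono[of "{v}" "pverts G"] by fastforce
  then obtain w where w: "w \<in> pverts G" "w \<noteq> v" by blast
  have "strongly_connected (with_proj G)"
    using assms(1) symmetric_connected_imp_strongly_connected pair_sym_arcs by blast
  then have "v \<rightarrow>\<^sup>*\<^bsub>with_proj G\<^esub> w" using w assms(3) by (simp add: strongly_connected_def)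
  then show ?thesis using w(2) by (cases rule: converse_reachable_cases) auto
qed

end

theorem theorem2p6:
  fixes G :: "'a pair_pre_digraph"
  assumes "pair_graph G"
    and "Digraph_Component.connected (with_proj G)"
    and "card (pverts G) \<ge> 3"
    and "upper_total_domination_number G < card (pverts G) - 1"
  shows "total_d0 G \<le>
    min (card (pverts G) - 1) (upper_total_domination_number G + total_domination_number G)"
proof -
  interpret pair_graph G by fact
  have iso: "\<exists>u. v \<rightarrow>\<^bsub>with_proj G\<^esub> u" if "v \<in> pverts G" for v
    using connected_no_isolated[OF assms(2) _ that] assms(3) by simp
  have V: "total_dominating_set G (pverts G)"
    using iso in_arcsD2 unfolding total_dominating_set_def with_proj_simps by blast
  have "Digraph_Component.connected (with_proj (total_dominating_graph k G))"
    if "card (pverts G) - 1 \<le> k" for k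
  proof (cases "k = card (pverts G) - 1")
    case True
    then show ?thesis using connected_card_minus_one[OF iso V assms(4)] by blast
  next
    case False
    then show ?thesis using connected_at_order[OF V] that by simp
  qed
  \<comment> \<open>Each of the two numbers is a threshold beyond which all graphs are connected, so
    the least threshold is below both.\<close>
  then show ?thesis
    unfolding total_d0_def min_def using connected_above_sum[OF V]
    by (auto intro!: Least_le)
qed

end
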